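(* Let $p\in\mathbb{R}_n[x,y]$ be a nonzero bivariate polynomial, of total degree at most $m$, with homogenization $p_H(x,y,z):=z^m p(x/z,y/z)$. Then $p$ is real stable if and only if the following two conditions hold: (1) the one-parameter family of univariate polynomials $q_\gamma(t)=p(\gamma+t,t)\in\mathbb{R}[t]$ is real-rooted for all $\gamma\in\mathbb{R}$; (2) the univariate polynomial $t\mapsto p_H(t,1-t,0)$ is strictly positive on the interval $(0,1)$.
   Context: $\mathbb{R}_n[x,y]$ denotes the vector space of real polynomials in $x,y$ of degree at most $n$ in each variable. A polynomial $p\in\mathbb{R}[x,y]$ is real stable if it is identically zero or if $p(z_1,z_2)\neq 0$ whenever $z_1,z_2\in\mathbb{C}$ satisfy $\mathrm{Im}(z_1)>0$ and $\mathrm{Im}(z_2)>0$. A univariate real polynomial is real-rooted if all of its roots are real; the zero polynomial is considered real-rooted.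
   Formalization: The formal theorem takes m to be exactly the total degree of p, and condition (2) reads "strictly positive on (0,1) or strictly negative on (0,1)"; as written the claim fails for p = 1, m = 1 and for p = -1, m = 0. *)

theory Defs
  imports Complex_Main "HOL-Computational_Algebra.Polynomial"
begin

text \<open>
  A polynomial in \<open>\<real>[x,y]\<close> is represented as an element of \<open>(\<real>[x])[y]\<close>: the outer
  variable is \<open>y\<close>, and the coefficient of \<open>x^i y^j\<close> is \<open>coeff (coeff p j) i\<close>.
\<close>

definition poly2 :: "'a::comm_ring_1 poly poly \<Rightarrow> 'a \<Rightarrow> 'a \<Rightarrow> 'a" where
  "poly2 p x y = poly (poly p [:y:]) x"

definition subst2 :: "'a::comm_ring_1 poly poly \<Rightarrow> 'a poly \<Rightarrow> 'a poly \<Rightarrow> 'a poly" where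
  "subst2 p u v = poly (map_poly (\<lambda>c. pcompose c u) p) v"

definition bivariate_polys :: "nat \<Rightarrow> real poly poly set" where
  "bivariate_polys n = {p. degree p \<le> n \<and> (\<forall>j. degree (coeff p j) \<le> n)}"

definition total_degree :: "'a::zero poly poly \<Rightarrow> nat" where
  "total_degree p = Max (insert 0 {i + j |i j. coeff (coeff p j) i \<noteq> 0})"

definition real_stable :: "real poly poly \<Rightarrow> bool" where
  "real_stable p \<longleftrightarrow> p = 0 \<or>
     (\<forall>z1 z2 :: complex. Im z1 > 0 \<longrightarrow> Im z2 > 0 \<longrightarrow>
        poly2 (map_poly (map_poly of_real) p) z1 z2 \<noteq> 0)"

definition real_rooted :: "real poly \<Rightarrow> bool" where
  "real_rooted q \<longleftrightarrow> q = 0 \<or> (\<forall>z :: complex. poly (map_poly of_real q) z = 0 \<longrightarrow> z \<in> \<real>)"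

definition diag_poly :: "real poly poly \<Rightarrow> real \<Rightarrow> real poly" where
  "diag_poly p \<gamma> = subst2 p [:\<gamma>, 1:] [:0, 1:]"

text \<open>
  The homogenization \<open>z^m p(x/z, y/z)\<close> as a polynomial function, so that it also has a value
  at \<open>z = 0\<close>.  It is only meaningful for \<open>total_degree p \<le> m\<close>; the truncated subtraction in
  the exponent of \<open>z\<close> is then exact on every nonzero term.
\<close>

definition homogenization :: "nat \<Rightarrow> real poly poly \<Rightarrow> real \<Rightarrow> real \<Rightarrow> real \<Rightarrow> real" where
  "homogenization m p x y z =
     (\<Sum>j\<le>degree p. \<Sum>i\<le>degree (coeff p j).
        coeff (coeff p j) i * x ^ i * y ^ j * z ^ (m - (i + j)))"

lemma poly2_altdef:
  "poly2 p x y = (\<Sum>j\<le>degree p. \<Sum>i\<le>degree (coeff p j). coeff (coeff p j) i * x ^ i * y ^ j)"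
  unfolding poly2_def poly_altdef[of p] poly_sum
  by (simp add: poly_altdef[of "coeff p _"] poly_power sum_distrib_right)

lemma poly_subst2: "poly (subst2 p u v) t = poly2 p (poly u t) (poly v t)"
  by (induction p) (simp_all add: subst2_def poly2_def map_poly_pCons poly_pcompose)

lemma poly_diag_poly: "poly (diag_poly p \<gamma>) t = poly2 p (\<gamma> + t) t"
  by (simp add: diag_poly_def poly_subst2)

lemma finite_support2: "finite {i + j |i j. coeff (coeff p j) i \<noteq> 0}"
proof -
  have "{i + j |i j. coeff (coeff p j) i \<noteq> 0} \<subseteq>
      (\<lambda>(i, j). i + j) ` (SIGMA i:(\<Union>j\<le>degree p. {..degree (coeff p j)}). {..degree p})"
  proof
    fix k assume "k \<in> {i + j |i j. coeff (coeff p j) i \<noteq> 0}"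
    then obtain i j where k: "k = i + j" "coeff (coeff p j) i \<noteq> 0" by auto
    then have "j \<le> degree p" "i \<le> degree (coeff p j)"
      by (auto intro: le_degree)
    with k show "k \<in> (\<lambda>(i, j). i + j) `
        (SIGMA i:(\<Union>j\<le>degree p. {..degree (coeff p j)}). {..degree p})"
      by force
  qed
  then show ?thesis by (rule finite_subset) auto
qed

lemma total_degree_le_iff:
  "total_degree p \<le> m \<longleftrightarrow> (\<forall>i j. coeff (coeff p j) i \<noteq> 0 \<longrightarrow> i + j \<le> m)"
  unfolding total_degree_def by (subst Max_le_iff) (use finite_support2 in auto)

lemma homogenization_eq:
  assumes "total_degree p \<le> m" and "z \<noteq> 0"
  shows "homogenization m p x y z = z ^ m * poly2 p (x / z) (y / z)"
  unfolding homogenization_def poly2_altdef sum_distrib_left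
proof (intro sum.cong refl)
  fix i j
  show "coeff (coeff p j) i * x ^ i * y ^ j * z ^ (m - (i + j)) =
      z ^ m * (coeff (coeff p j) i * (x / z) ^ i * (y / z) ^ j)"
  proof (cases "coeff (coeff p j) i = 0")
    case False
    with assms(1) have "i + j \<le> m" by (simp add: total_degree_le_iff)
    then have "z ^ m = z ^ (m - (i + j)) * z ^ i * z ^ j"
      by (simp flip: power_add)
    with \<open>z \<noteq> 0\<close> show ?thesis by (simp add: power_divide)
  qed simp
qed

end

theory Submission
  imports Defs "HOL-Analysis.Analysis" "HOL-Computational_Algebra.Fundamental_Theorem_Algebra"
begin

text \<open>
  Write \<open>P\<close> for the complexified \<open>p\<close> and \<open>T\<close> for its leading form. A univariate polynomial of
  degree \<open>m\<close> with leading coefficient \<open>c\<close> and no root within distance \<open>r\<close> of \<open>s\<close> has absolute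
  value at least \<open>|c| r^m\<close> at \<open>s\<close>. On lines of direction \<open>v\<close> the leading coefficient of \<open>P\<close>
  is \<open>T v\<close>, so this bound replaces Hurwitz' theorem in both directions.

  If \<open>p\<close> is stable, apply the bound to \<open>\<epsilon>^m P (z / \<epsilon>)\<close> near \<open>z = (i a, i b)\<close> along a direction
  on which \<open>T\<close> does not vanish; letting \<open>\<epsilon>\<close> tend to \<open>0\<close> gives \<open>T (a, b) \<noteq> 0\<close> for positive
  \<open>a\<close> and \<open>b\<close>.

  The converse is Garding's homotopy argument. Condition (1) says that \<open>P (x + \<zeta> e) \<noteq> 0\<close> for
  \<open>e = (1, 1)\<close>, real \<open>x\<close> and nonreal \<open>\<zeta>\<close>. Hence for \<open>\<alpha> > 0\<close> and real \<open>v\<close> the polynomial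
  \<open>s \<mapsto> P (x + i \<alpha> e + s v)\<close> has no real root; if \<open>v = e\<close>, it has no root in the upper half plane
  either. Moving \<open>v\<close> from \<open>e\<close> to \<open>(a - \<alpha>, b - \<alpha>)\<close> inside the positive quadrant, roots cannot
  come in from infinity, as \<open>T v \<noteq> 0\<close>, and cannot cross the real axis. In particular \<open>s = i\<close> is
  not a root at the end, that is, \<open>P (x + i (a, b)) \<noteq> 0\<close>.
\<close>

section \<open>Lower bounds from root-free discs\<close>

text \<open>Each of the \<open>m\<close> linear factors has absolute value at least \<open>r\<close>
  at \<open>s\<close>. If the degree drops below \<open>m\<close>, the left side is at most
  zero.\<close>

lemma norm_poly_ge_root_free_ball:
  fixes f :: "complex poly"
  assumes "degree f \<le> m" and "r \<ge> 0" and "\<And>w. dist s w < r \<Longrightarrow> poly f w \<noteq> 0"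
  shows "norm (coeff f m) * r ^ m \<le> norm (poly f s)"
proof (cases "coeff f m = 0")
  case False
  then have deg: "degree f = m"
    using assms(1) by (simp add: le_antisym le_degree)
  from False have "f \<noteq> 0" by auto
  obtain root where root: "smult (lead_coeff f) (\<Prod>i<degree f. [:-root i, 1:]) = f"
    by (rule complex_poly_decompose')
  have poly_f: "poly f w = lead_coeff f * (\<Prod>i<m. w - root i)" for w
    by (subst root[symmetric]) (simp add: poly_prod deg)
  have "r \<le> norm (s - root i)" if "i < m" for i
  proof -
    have "poly f (root i) = 0"
      using that by (auto simp: poly_f)
    then show ?thesis
      using assms(3)[of "root i"] by (force simp: dist_norm)
  qed
  then have "(\<Prod>i<m. r) \<le> (\<Prod>i<m. norm (s - root i))"
    using assms(2) by (intro prod_mono) auto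
  then show ?thesis
    by (simp add: poly_f norm_mult prod_norm deg mult_left_mono)
qed (use assms(2) in auto)

lemma coeff_mult_degree_le:
  fixes f g :: "'a::comm_semiring_0 poly"
  assumes "degree f \<le> m" and "degree g \<le> n"
  shows "coeff (f * g) (m + n) = coeff f m * coeff g n"
proof -
  have "coeff f i * coeff g (m + n - i) = 0" if "i \<noteq> m" for i
    using that assms by (cases "i < m") (simp_all add: coeff_eq_0)
  then have "coeff (f * g) (m + n) = (\<Sum>i\<in>{m}. coeff f i * coeff g (m + n - i))"
    unfolding coeff_mult by (intro sum.mono_neutral_right) auto
  then show ?thesis by simp
qed

lemma linear_power_degree_coeff:
  fixes a b :: "'a::comm_semiring_1"
  shows "degree ([:a, b:] ^ n) \<le> n" and "coeff ([:a, b:] ^ n) n = b ^ n"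
proof -
  have deg: "degree ([:a, b:] ^ k) \<le> k" for k
    using degree_power_le[of "[:a, b:]" k] degree_pCons_le[of a "[:b:]"]
    by (simp split: if_splits)
  then show "degree ([:a, b:] ^ n) \<le> n" .
  show "coeff ([:a, b:] ^ n) n = b ^ n"
  proof (induction n)
    case (Suc n)
    have "coeff ([:a, b:] * [:a, b:] ^ n) (1 + n) = coeff [:a, b:] 1 * coeff ([:a, b:] ^ n) n"
      by (rule coeff_mult_degree_le) (use deg in auto)
    with Suc show ?case by simp
  qed simp
qed

section \<open>Homogenization on complex lines\<close>

text \<open>
  The homogenization at complex arguments: \<open>chom m p x y 1\<close> is the value of \<open>p\<close>, and
  \<open>chom m p x y 0\<close> is the value of the part of \<open>p\<close> of degree \<open>m\<close>.
\<close>

definition chom :: "nat \<Rightarrow> real poly poly \<Rightarrow> complex \<Rightarrow> complex \<Rightarrow> complex \<Rightarrow> complex" where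
  "chom m p x y z = (\<Sum>j\<le>degree p. \<Sum>i\<le>degree (coeff p j).
     of_real (coeff (coeff p j) i) * (x ^ i * y ^ j * z ^ (m - (i + j))))"

lemma chom_of_real:
  "chom m p (of_real x) (of_real y) (of_real z) = of_real (homogenization m p x y z)"
  by (simp add: chom_def homogenization_def mult.assoc)

lemma chom_of_real_0: "chom m p (of_real x) (of_real y) 0 = of_real (homogenization m p x y 0)"
  using chom_of_real[of m p x y 0] by simp

lemma poly2_complexify: "poly2 (map_poly (map_poly of_real) p) x y = chom m p x y 1"
  by (simp add: poly2_altdef chom_def degree_map_poly coeff_map_poly mult.assoc
      map_poly_eq_0_iff)

lemma continuous_on_chom [continuous_intros]:
  "continuous_on A f \<Longrightarrow> continuous_on A g \<Longrightarrow> continuous_on A h \<Longrightarrow>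
    continuous_on A (\<lambda>x. chom m p (f x) (g x) (h x))"
  unfolding chom_def by (intro continuous_intros)

lemma chom_scale:
  assumes "total_degree p \<le> m"
  shows "chom m p (k * x) (k * y) (k * z) = k ^ m * chom m p x y z"
  unfolding chom_def sum_distrib_left
proof (intro sum.cong refl)
  fix i j
  show "of_real (coeff (coeff p j) i) * ((k * x) ^ i * (k * y) ^ j * (k * z) ^ (m - (i + j))) =
      k ^ m * (of_real (coeff (coeff p j) i) * (x ^ i * y ^ j * z ^ (m - (i + j))))"
  proof (cases "coeff (coeff p j) i = 0")
    case False
    with assms have "i + j \<le> m" by (simp add: total_degree_le_iff)
    then have "k ^ m = k ^ i * k ^ j * k ^ (m - (i + j))"
      by (simp flip: power_add)
    then show ?thesis by (simp add: power_mult_distrib)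
  qed simp
qed

text \<open>Each monomial becomes a product of \<open>m\<close> linear polynomials in
  \<open>w\<close>, whose top coefficients multiply to the monomial at \<open>v\<close>. For
  \<open>v3 = 0\<close> the coefficient of \<open>w^m\<close> is thus the leading form at the
  direction.\<close>

lemma chom_line:
  assumes "total_degree p \<le> m"
  obtains f where "degree f \<le> m" and "coeff f m = chom m p v1 v2 v3"
    and "\<And>w. poly f w = chom m p (x1 + w * v1) (x2 + w * v2) (x3 + w * v3)"
proof
  define g where "g i j = [:x1, v1:] ^ i * [:x2, v2:] ^ j * [:x3, v3:] ^ (m - (i + j))" for i j
  define f where "f = (\<Sum>j\<le>degree p. \<Sum>i\<le>degree (coeff p j).
    smult (of_real (coeff (coeff p j) i)) (g i j))"
  have g: "degree (g i j) \<le> m" "coeff (g i j) m = v1 ^ i * v2 ^ j * v3 ^ (m - (i + j))"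
    if "i + j \<le> m" for i j
  proof -
    have deg2: "degree ([:x1, v1:] ^ i * [:x2, v2:] ^ j) \<le> i + j"
      by (rule order.trans[OF degree_mult_le]) (intro add_mono linear_power_degree_coeff)
    have "degree (g i j) \<le> (i + j) + (m - (i + j))"
      unfolding g_def
      by (rule order.trans[OF degree_mult_le]) (intro add_mono deg2 linear_power_degree_coeff)
    then show "degree (g i j) \<le> m" using that by simp
    have "coeff (g i j) ((i + j) + (m - (i + j))) = v1 ^ i * v2 ^ j * v3 ^ (m - (i + j))"
      unfolding g_def
      by (subst coeff_mult_degree_le[OF deg2 linear_power_degree_coeff(1)],
          subst coeff_mult_degree_le[OF linear_power_degree_coeff(1) linear_power_degree_coeff(1)])
        (simp add: linear_power_degree_coeff(2))
    then show "coeff (g i j) m = v1 ^ i * v2 ^ j * v3 ^ (m - (i + j))" using that by simp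
  qed
  have ij: "i + j \<le> m" if "coeff (coeff p j) i \<noteq> 0" for i j
    using assms that by (simp add: total_degree_le_iff)
  have "degree (smult (of_real (coeff (coeff p j) i)) (g i j)) \<le> m" for i j
    using g(1) ij by (cases "coeff (coeff p j) i = 0") auto
  then show "degree f \<le> m"
    unfolding f_def by (intro degree_sum_le) auto
  have "coeff (smult (of_real (coeff (coeff p j) i)) (g i j)) m =
      of_real (coeff (coeff p j) i) * (v1 ^ i * v2 ^ j * v3 ^ (m - (i + j)))" for i j
    using g(2) ij by (cases "coeff (coeff p j) i = 0") auto
  then show "coeff f m = chom m p v1 v2 v3"
    unfolding f_def coeff_sum chom_def by (intro sum.cong refl)
  show "poly f w = chom m p (x1 + w * v1) (x2 + w * v2) (x3 + w * v3)" for w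
    by (simp add: f_def g_def chom_def poly_sum)
qed

lemma norm_chom_ge:
  assumes "total_degree p \<le> m" and "r \<ge> 0"
    and "\<And>w. dist s w < r \<Longrightarrow> chom m p (x1 + w * v1) (x2 + w * v2) (x3 + w * v3) \<noteq> 0"
  shows "norm (chom m p v1 v2 v3) * r ^ m \<le>
    norm (chom m p (x1 + s * v1) (x2 + s * v2) (x3 + s * v3))"
proof -
  obtain f where "degree f \<le> m" "coeff f m = chom m p v1 v2 v3"
    "\<And>w. poly f w = chom m p (x1 + w * v1) (x2 + w * v2) (x3 + w * v3)"
    using chom_line[OF assms(1)] by blast
  with norm_poly_ge_root_free_ball[of f m r s] assms(2,3) show ?thesis
    by metis
qed

lemma poly_map_poly_of_real: "poly (map_poly of_real q) (of_real t :: complex) = of_real (poly q t)"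
  by (induction q) (simp_all add: map_poly_pCons)

text \<open>Polynomials that agree at all real points are equal. The coefficient at \<open>m\<close>
  later excludes \<open>diag_poly p \<gamma> = 0\<close>, for which real-rootedness would say
  nothing about roots.\<close>

lemma complexify_diag_poly:
  assumes "total_degree p \<le> m"
  shows "coeff (map_poly of_real (diag_poly p \<gamma>) :: complex poly) m = chom m p 1 1 0"
    and "poly (map_poly of_real (diag_poly p \<gamma>)) w = chom m p (of_real \<gamma> + w) w 1"
proof -
  obtain f where f: "coeff f m = chom m p 1 1 0"
    "\<And>w. poly f w = chom m p (of_real \<gamma> + w * 1) (0 + w * 1) (1 + w * 0)"
    using chom_line[OF assms] by blast
  have "poly f (of_real t) = poly (map_poly of_real (diag_poly p \<gamma>)) (of_real t)" for t
  proof -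
    have "homogenization m p (\<gamma> + t) t 1 = poly2 p (\<gamma> + t) t"
      using homogenization_eq[OF assms, of 1] by simp
    then show ?thesis
      using chom_of_real[of m p "\<gamma> + t" t 1]
      by (simp add: f(2) poly_map_poly_of_real poly_diag_poly)
  qed
  then have "range (of_real :: real \<Rightarrow> complex) \<subseteq>
      {w. poly (f - map_poly of_real (diag_poly p \<gamma>)) w = 0}" by auto
  moreover have "infinite (range (of_real :: real \<Rightarrow> complex))"
    by (simp add: finite_image_iff inj_of_real infinite_UNIV_char_0)
  ultimately have "f - map_poly of_real (diag_poly p \<gamma>) = 0"
    using poly_roots_finite infinite_super by blast
  then have "map_poly of_real (diag_poly p \<gamma>) = f" by simp
  with f show "coeff (map_poly of_real (diag_poly p \<gamma>) :: complex poly) m = chom m p 1 1 0"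
    "poly (map_poly of_real (diag_poly p \<gamma>)) w = chom m p (of_real \<gamma> + w) w 1"
    by auto
qed

section \<open>The leading form\<close>

text \<open>In a fixed total degree a monomial is determined by its exponent \<open>i\<close>, so
  setting \<open>y = 1\<close> causes no cancellation.\<close>

lemma leading_form_nonzero:
  assumes "p \<noteq> 0"
  obtains x where "chom (total_degree p) p x 1 0 \<noteq> 0"
proof -
  let ?S = "{i + j |i j. coeff (coeff p j) i \<noteq> 0}"
  obtain i0 j0 where nz: "coeff (coeff p j0) i0 \<noteq> 0" and deg: "total_degree p = i0 + j0"
  proof -
    have "lead_coeff (lead_coeff p) \<noteq> 0" using assms by simp
    then have "?S \<noteq> {}" by blast
    then have "total_degree p = Max ?S"
      using finite_support2[of p] by (simp add: total_degree_def)
    with Max_in[OF finite_support2 \<open>?S \<noteq> {}\<close>] show ?thesis using that by auto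
  qed
  define f :: "complex poly" where "f = (\<Sum>j\<le>degree p. \<Sum>i\<le>degree (coeff p j).
    if i + j = total_degree p then monom (of_real (coeff (coeff p j) i)) i else 0)"
  have "poly f x = chom (total_degree p) p x 1 0" for x
    unfolding f_def chom_def poly_sum
  proof (intro sum.cong refl)
    fix i j
    show "poly (if i + j = total_degree p
          then monom (of_real (coeff (coeff p j) i)) i else 0) x =
        of_real (coeff (coeff p j) i) * (x ^ i * 1 ^ j * 0 ^ (total_degree p - (i + j)))"
    proof (cases "coeff (coeff p j) i = 0")
      case False
      then have "i + j \<le> total_degree p"
        using total_degree_le_iff[of p "total_degree p"] by blast
      then show ?thesis by (auto simp: poly_monom zero_power)
    qed simp
  qed
  moreover have "coeff f i0 = of_real (coeff (coeff p j0) i0)"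
  proof -
    have "coeff f i0 = (\<Sum>j\<le>degree p. \<Sum>i\<le>degree (coeff p j).
        if i = i0 \<and> j = j0 then of_real (coeff (coeff p j) i) else 0)"
      unfolding f_def coeff_sum by (intro sum.cong refl) (auto simp: deg)
    also have "\<dots> = (\<Sum>j\<le>degree p. if j = j0 then of_real (coeff (coeff p j) i0) else 0)"
    proof (intro sum.cong refl)
      fix j
      show "(\<Sum>i\<le>degree (coeff p j).
            if i = i0 \<and> j = j0 then of_real (coeff (coeff p j) i) else 0) =
          (if j = j0 then of_real (coeff (coeff p j) i0) else (0::complex))"
        using nz by (cases "j = j0") (auto simp: le_degree)
    qed
    also have "\<dots> = of_real (coeff (coeff p j0) i0)"
    proof -
      have "coeff p j0 \<noteq> 0" using nz by auto
      then show ?thesis by (auto simp: le_degree)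
    qed
    finally show ?thesis .
  qed
  then have "f \<noteq> 0" using nz by auto
  ultimately show ?thesis
    using that poly_all_0_iff_0[of f] by auto
qed

lemma stable_leading_form_nonzero:
  assumes "p \<noteq> 0"
    and stable: "\<And>z1 z2. Im z1 > 0 \<Longrightarrow> Im z2 > 0 \<Longrightarrow> chom (total_degree p) p z1 z2 1 \<noteq> 0"
    and "a > 0" and "b > 0"
  shows "chom (total_degree p) p (of_real a) (of_real b) 0 \<noteq> 0"
proof -
  let ?H = "chom (total_degree p) p"
  obtain c where c: "?H c 1 0 \<noteq> 0"
    using leading_form_nonzero[OF assms(1)] by blast
  \<comment> \<open>Moving by less than \<open>r\<close> along \<open>(c, 1)\<close> keeps both
    imaginary parts positive.\<close>
  define r where "r = min (a / (1 + norm c)) b"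
  have "r > 0"
    using assms(3,4) by (simp add: r_def add_pos_nonneg)
  have nz: "?H (\<i> * of_real a + w * c) (\<i> * of_real b + w * 1) (of_real e + w * 0) \<noteq> 0"
    if "dist 0 w < r" "e > 0" for w e
  proof -
    define z1 z2 where "z1 = \<i> * of_real a + w * c" and "z2 = \<i> * of_real b + w"
    have "norm w * norm c \<le> norm w * (1 + norm c)"
      by (intro mult_left_mono) auto
    also have "\<dots> < a"
      using that(1) by (simp add: r_def pos_less_divide_eq add_pos_nonneg)
    finally have "Im z1 > 0"
      using abs_Im_le_cmod[of "w * c"] by (simp add: z1_def norm_mult)
    moreover have "Im z2 > 0"
      using abs_Im_le_cmod[of w] that(1) by (auto simp: z2_def r_def)
    ultimately have "?H (z1 / of_real e) (z2 / of_real e) 1 \<noteq> 0"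
      using that(2) by (intro stable) simp_all
    then show ?thesis
      using chom_scale[of p "total_degree p" "of_real e" "z1 / of_real e" "z2 / of_real e" 1] that(2)
      by (simp add: z1_def z2_def)
  qed
  have bound: "norm (?H c 1 0) * r ^ total_degree p \<le>
      norm (?H (\<i> * of_real a) (\<i> * of_real b) (of_real e))" if "e > 0" for e
    using norm_chom_ge[OF order.refl, of r 0] nz that \<open>r > 0\<close> by force
  have "continuous_on UNIV (\<lambda>e::real. norm (?H (\<i> * of_real a) (\<i> * of_real b) (of_real e)))"
    by (intro continuous_intros)
  then have "((\<lambda>e::real. norm (?H (\<i> * of_real a) (\<i> * of_real b) (of_real e))) \<longlongrightarrow>
      norm (?H (\<i> * of_real a) (\<i> * of_real b) (of_real 0))) (at_right 0)"
    by (metis UNIV_I continuous_on_def filterlim_at_split)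
  then have "norm (?H c 1 0) * r ^ total_degree p \<le>
      norm (?H (\<i> * of_real a) (\<i> * of_real b) (of_real 0))"
    by (rule tendsto_lowerbound)
      (auto intro: bound eventually_mono[OF eventually_at_right_less])
  \<comment> \<open>Writing the last argument as \<open>\<i> * 0\<close> lets homogeneity pull out a
    power of \<open>\<i>\<close>.\<close>
  then have "?H (\<i> * of_real a) (\<i> * of_real b) (\<i> * 0) \<noteq> 0"
    using c zero_less_power[OF \<open>r > 0\<close>, of "total_degree p"] by (auto simp: mult_le_0_iff)
  then show ?thesis
    by (subst (asm) chom_scale) auto
qed

section \<open>Garding's homotopy\<close>

lemma homotopy_root_free:
  assumes "total_degree p \<le> m"
    and diag: "\<And>X1 X2 \<zeta>. Im \<zeta> \<noteq> 0 \<Longrightarrow> chom m p (of_real X1 + \<zeta>) (of_real X2 + \<zeta>) 1 \<noteq> 0"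
    and pos: "\<And>a b::real. a > 0 \<Longrightarrow> b > 0 \<Longrightarrow> chom m p (of_real a) (of_real b) 0 \<noteq> 0"
    and "a > 0" and "b > 0"
  shows "chom m p (of_real X1 + \<i> * of_real a) (of_real X2 + \<i> * of_real b) 1 \<noteq> 0"
proof -
  \<comment> \<open>The direction \<open>(v a \<theta>, v b \<theta>)\<close> runs from
    \<open>(1, 1)\<close> to \<open>(a - \<alpha>, b - \<alpha>)\<close>, which is positive by the
    choice of \<open>\<alpha>\<close>.\<close>
  define \<alpha> where "\<alpha> = min a b / 2"
  define v where "v c \<theta> = 1 - \<theta> + \<theta> * (c - \<alpha>)" for c \<theta> :: real
  have \<alpha>: "\<alpha> > 0" "\<alpha> < a" "\<alpha> < b"
    using assms(4,5) by (auto simp: \<alpha>_def)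
  have v_pos: "v c \<theta> > 0" if "\<theta> \<in> {0..1}" "c > \<alpha>" for c \<theta>
  proof (cases "\<theta> = 1")
    case False
    with that show ?thesis by (auto simp: v_def intro!: add_pos_nonneg)
  qed (use that in \<open>auto simp: v_def\<close>)
  \<comment> \<open>Homogeneous in \<open>(s, z)\<close>: \<open>z = 1\<close> gives the polynomial
    in \<open>s\<close>, and \<open>F \<theta> 1 0\<close> is the leading form at the direction, so
    that \<open>z = 0\<close> stands for \<open>s\<close> at infinity.\<close>
  define F where "F \<theta> s z = chom m p (z * (of_real X1 + \<i> * of_real \<alpha>) + s * of_real (v a \<theta>))
    (z * (of_real X2 + \<i> * of_real \<alpha>) + s * of_real (v b \<theta>)) z" for \<theta> s z
  define T where "T \<theta> = norm (chom m p (of_real (v a \<theta>)) (of_real (v b \<theta>)) 0)" for \<theta>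
  have T_pos: "T \<theta> > 0" if "\<theta> \<in> {0..1}" for \<theta>
    using pos v_pos that \<alpha> by (simp add: T_def)
  have F_scale: "F \<theta> s 1 = s ^ m * F \<theta> 1 (1 / s)" if "s \<noteq> 0" for \<theta> s
    unfolding F_def using that
    by (subst chom_scale[OF assms(1), symmetric]) (simp add: algebra_simps)
  have F_real: "F \<theta> s 1 \<noteq> 0" if "Im s = 0" for \<theta> s
  proof -
    have s: "s = of_real (Re s)" using that by (simp add: complex_eq_iff)
    show ?thesis
      using diag[of "\<i> * of_real \<alpha>" "X1 + Re s * v a \<theta>" "X2 + Re s * v b \<theta>"] \<alpha>(1)
      by (subst s) (simp add: F_def algebra_simps)
  qed
  \<comment> \<open>\<open>B\<close> describes the complement of \<open>A\<close> in the unit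
    interval by conditions closed in \<open>\<theta>\<close>. Both sets being closed, connectedness
    makes one of them empty, without following individual roots.\<close>
  define A where "A = {\<theta>\<in>{0..1}. \<exists>s. Im s \<ge> 0 \<and> F \<theta> s 1 = 0}"
  define A1 where "A1 = fst ` ({0..1} \<times> (cball 0 1 \<inter> {s. Im s \<ge> 0}) \<inter> {x. F (fst x) (snd x) 1 = 0})"
  define A2 where "A2 = fst ` ({0..1} \<times> (cball 0 1 \<inter> {u. Im u \<le> 0}) \<inter> {x. F (fst x) 1 (snd x) = 0})"
  define B where "B = {0..1} \<inter> (\<Inter>s\<in>{s. Im s > 0}. {\<theta>. norm (F \<theta> s 1) \<ge> T \<theta> * Im s ^ m})"
  \<comment> \<open>\<open>A2\<close> covers the roots outside the unit disc in the coordinate \<open>u = 1 / s\<close>, so that both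
    sets are projections of compact sets.\<close>
  have "A = A1 \<union> A2"
  proof (intro equalityI subsetI)
    fix \<theta> assume "\<theta> \<in> A"
    then obtain s where s: "\<theta> \<in> {0..1}" "Im s \<ge> 0" "F \<theta> s 1 = 0" by (auto simp: A_def)
    show "\<theta> \<in> A1 \<union> A2"
    proof (cases "norm s \<le> 1")
      case True
      with s have "(\<theta>, s) \<in> {0..1} \<times> (cball 0 1 \<inter> {s. Im s \<ge> 0}) \<inter> {x. F (fst x) (snd x) 1 = 0}"
        by auto
      then show ?thesis unfolding A1_def by force
    next
      case False
      then have "s \<noteq> 0" by auto
      have "norm (1 / s) \<le> 1" using False by (simp add: norm_divide divide_le_eq)
      moreover have "Im (1 / s) \<le> 0" using s(2) by (simp add: Im_divide divide_nonpos_nonneg)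
      moreover have "F \<theta> 1 (1 / s) = 0" using F_scale[OF \<open>s \<noteq> 0\<close>] s(3) \<open>s \<noteq> 0\<close> by auto
      ultimately have "(\<theta>, 1 / s) \<in> {0..1} \<times> (cball 0 1 \<inter> {u. Im u \<le> 0}) \<inter> {x. F (fst x) 1 (snd x) = 0}"
        using s(1) by auto
      then show ?thesis unfolding A2_def by force
    qed
  next
    fix \<theta> assume "\<theta> \<in> A1 \<union> A2"
    then show "\<theta> \<in> A"
    proof
      assume "\<theta> \<in> A2"
      then obtain u where u: "\<theta> \<in> {0..1}" "Im u \<le> 0" "F \<theta> 1 u = 0" by (auto simp: A2_def)
      have "u \<noteq> 0"
        using u(3) T_pos[OF u(1)] by (auto simp: F_def T_def)
      then have "F \<theta> (1 / u) 1 = 0"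
        using F_scale[of "1 / u"] u(3) by simp
      moreover have "Im (1 / u) \<ge> 0" using u(2) by (simp add: Im_divide divide_nonpos_nonneg)
      ultimately show ?thesis using u(1) by (auto simp: A_def)
    qed (auto simp: A1_def A_def)
  qed
  moreover have "compact A1" "compact A2"
    unfolding A1_def A2_def F_def v_def
    by (intro compact_continuous_image compact_Int_closed compact_Times closed_Collect_eq
        closed_halfspace_Im_ge closed_halfspace_Im_le continuous_intros compact_cball
        compact_Icc)+
  ultimately have "closed A" by (auto intro: compact_imp_closed)
  moreover have "closed B"
    unfolding B_def F_def v_def T_def
    by (intro closed_Int closed_INT ballI closed_Collect_le continuous_intros closed_atLeastAtMost)
  moreover have "A \<inter> B = {}"
  proof -
    have "\<theta> \<notin> B" if "\<theta> \<in> A" for \<theta>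
    proof
      assume "\<theta> \<in> B"
      from that obtain s where s: "\<theta> \<in> {0..1}" "Im s \<ge> 0" "F \<theta> s 1 = 0"
        by (auto simp: A_def)
      with F_real[of s \<theta>] have "Im s > 0" by linarith
      with \<open>\<theta> \<in> B\<close> s(3) have "T \<theta> * Im s ^ m \<le> 0" by (force simp: B_def)
      with T_pos[OF s(1)] zero_less_power[OF \<open>Im s > 0\<close>, of m] show False
        by (auto simp: mult_le_0_iff)
    qed
    then show ?thesis by auto
  qed
  moreover have "{0..1} \<subseteq> A \<union> B"
  proof
    fix \<theta> :: real assume \<theta>: "\<theta> \<in> {0..1}"
    have "T \<theta> * Im s ^ m \<le> norm (F \<theta> s 1)" if "\<theta> \<notin> A" "Im s > 0" for s
    proof -
      \<comment> \<open>The disc of radius \<open>Im s\<close> about \<open>s\<close> stays in the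
        upper half plane.\<close>
      have "F \<theta> w 1 \<noteq> 0" if "dist s w < Im s" for w
      proof -
        have "Im w > 0"
          using that abs_Im_le_cmod[of "s - w"] by (simp add: dist_norm)
        with \<open>\<theta> \<notin> A\<close> \<theta> show ?thesis by (auto simp: A_def)
      qed
      then show ?thesis
        using norm_chom_ge[OF assms(1), of "Im s" s _ "of_real (v a \<theta>)" _ "of_real (v b \<theta>)" 1 0] that
        unfolding F_def T_def by simp
    qed
    with \<theta> show "\<theta> \<in> A \<union> B" by (auto simp: B_def)
  qed
  ultimately have "A = {} \<or> {0..1} \<inter> B = {}"
    using connected_closedD[of "{0..1::real}" A B] by (auto simp: A_def)
  moreover have "0 \<notin> A"
  proof -
    have "F 0 s 1 \<noteq> 0" if "Im s \<ge> 0" for s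
      using diag[of "\<i> * of_real \<alpha> + s" X1 X2] that \<alpha>(1)
      by (simp add: F_def v_def algebra_simps)
    then show ?thesis by (auto simp: A_def)
  qed
  ultimately have "A = {}"
    using \<open>{0..1} \<subseteq> A \<union> B\<close> by force
  \<comment> \<open>The imaginary parts add up to \<open>\<alpha> + (a - \<alpha>) = a\<close>, and
    likewise to \<open>b\<close>.\<close>
  then have "F 1 \<i> 1 \<noteq> 0"
    by (auto simp: A_def)
  then show ?thesis
    by (simp add: F_def v_def algebra_simps)
qed

section \<open>The equivalence\<close>

text \<open>Stability and real-rootedness are the same for \<open>p\<close> and \<open>-p\<close>,
  so only a constant sign can be asked for. For \<open>m\<close> above the total degree the form at
  \<open>z = 0\<close> would vanish identically.\<close>

theorem theorem3p1:
  fixes n m :: nat and p :: "real poly poly"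
  assumes "p \<in> bivariate_polys n" and "p \<noteq> 0" and "total_degree p = m"
  shows "real_stable p \<longleftrightarrow>
    (\<forall>\<gamma>::real. real_rooted (diag_poly p \<gamma>)) \<and>
    ((\<forall>t\<in>{0<..<1::real}. homogenization m p t (1 - t) 0 > 0) \<or>
     (\<forall>t\<in>{0<..<1::real}. homogenization m p t (1 - t) 0 < 0))"
    (is "_ \<longleftrightarrow> ?rooted \<and> ?signed")
proof -
  have deg: "total_degree p \<le> m" using assms(3) by simp
  note diag = complexify_diag_poly[OF deg]
  have stable_iff: "real_stable p \<longleftrightarrow>
      (\<forall>z1 z2. Im z1 > 0 \<longrightarrow> Im z2 > 0 \<longrightarrow> chom m p z1 z2 1 \<noteq> 0)"
    using assms(2) by (simp add: real_stable_def poly2_complexify[of p _ _ m])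
  have rooted_iff: "real_rooted (diag_poly p \<gamma>) \<longleftrightarrow> diag_poly p \<gamma> = 0 \<or>
      (\<forall>z. chom m p (of_real \<gamma> + z) z 1 = 0 \<longrightarrow> z \<in> \<real>)" for \<gamma>
    by (simp add: real_rooted_def diag(2))
  show ?thesis
  proof (intro iffI conjI)
    assume "real_stable p"
    then have stable: "chom m p z1 z2 1 \<noteq> 0" if "Im z1 > 0" "Im z2 > 0" for z1 z2
      using that stable_iff by blast
    show ?rooted
    proof
      fix \<gamma>
      have "z \<in> \<real>" if root: "chom m p (of_real \<gamma> + z) z 1 = 0" for z
      proof (rule ccontr)
        assume "z \<notin> \<real>"
        then have "Im z \<noteq> 0" by (simp add: complex_is_Real_iff)
        \<comment> \<open>The coefficients are real, so a root in the lower half plane has a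
          conjugate root in the upper one.\<close>
        moreover have "chom m p (of_real \<gamma> + cnj z) (cnj z) 1 = cnj (chom m p (of_real \<gamma> + z) z 1)"
          by (simp add: chom_def)
        ultimately show False
          using stable[of "of_real \<gamma> + z" z] stable[of "of_real \<gamma> + cnj z" "cnj z"] root
          by (cases "Im z > 0") auto
      qed
      then show "real_rooted (diag_poly p \<gamma>)" by (simp add: rooted_iff)
    qed
    have nz: "homogenization m p t (1 - t) 0 \<noteq> 0" if "t \<in> {0<..<1}" for t
      using stable_leading_form_nonzero[OF assms(2), of t "1 - t"] stable assms(3) that
      by (simp only: chom_of_real_0) auto
    show ?signed
    proof (rule ccontr)
      assume "\<not> ?signed"
      then obtain t u where "t \<in> {0<..<1}" "homogenization m p t (1 - t) 0 \<le> 0"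
        "u \<in> {0<..<1}" "homogenization m p u (1 - u) 0 \<ge> 0"
        by (auto simp: not_less)
      moreover have "connected ((\<lambda>t. homogenization m p t (1 - t) 0) ` {0<..<1})"
        unfolding homogenization_def
        by (intro connected_continuous_image continuous_intros connected_Ioo)
      ultimately have "0 \<in> (\<lambda>t. homogenization m p t (1 - t) 0) ` {0<..<1}"
        using connectedD_interval by blast
      with nz show False by auto
    qed
  next
    assume R: "?rooted \<and> ?signed"
    have pos: "chom m p (of_real a) (of_real b) 0 \<noteq> 0" if "a > 0" "b > 0" for a b :: real
    proof -
      define t where "t = a / (a + b)"
      have t: "t \<in> {0<..<1}" "a = (a + b) * t" "b = (a + b) * (1 - t)"
        using that by (auto simp: t_def field_simps)
      then have "homogenization m p t (1 - t) 0 \<noteq> 0"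
        using R by force
      then have "of_real (a + b) ^ m * chom m p (of_real t) (of_real (1 - t)) 0 \<noteq> 0"
        using that unfolding chom_of_real_0 by (simp flip: of_real_add)
      then have "chom m p (of_real ((a + b) * t)) (of_real ((a + b) * (1 - t))) 0 \<noteq> 0"
        by (subst (asm) chom_scale[OF deg, symmetric]) simp
      then show ?thesis using t(2,3) by simp
    qed
    have nonreal: "chom m p (of_real X1 + \<zeta>) (of_real X2 + \<zeta>) 1 \<noteq> 0" if "Im \<zeta> \<noteq> 0" for X1 X2 \<zeta>
    proof -
      \<comment> \<open>The point lies on the diagonal line with \<open>\<gamma> = X1 - X2\<close>,
        at parameter \<open>X2 + \<zeta>\<close>.\<close>
      have "diag_poly p (X1 - X2) \<noteq> 0"
        using diag(1)[of "X1 - X2"] pos[of 1 1] by auto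
      moreover have "of_real X2 + \<zeta> \<notin> \<real>"
        using that by (simp add: complex_is_Real_iff)
      ultimately have "chom m p (of_real (X1 - X2) + (of_real X2 + \<zeta>)) (of_real X2 + \<zeta>) 1 \<noteq> 0"
        using R rooted_iff by blast
      then show ?thesis by (simp add: algebra_simps)
    qed
    show "real_stable p"
      unfolding stable_iff
    proof (intro allI impI)
      fix z1 z2 :: complex assume "Im z1 > 0" "Im z2 > 0"
      then show "chom m p z1 z2 1 \<noteq> 0"
        using homotopy_root_free[OF deg nonreal pos, of "Im z1" "Im z2" "Re z1" "Re z2"]
        by (simp flip: complex_eq)
    qed
  qed
qed

end
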